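(* Consider the dynamics $\dot x=f(t,x)$ with $f:\mathbb{R}_{\ge0}\times\mathbb{R}^n\to\mathbb{R}^n$ continuous in $(t,x)$. Let $C\subseteq\mathbb{R}^n$ be open, connected, and forward invariant, and let $\|\cdot\|$ be a norm on $\mathbb{R}^n$ with compatible weak pairing $[\![\cdot,\cdot]\!]$ satisfying Deimling's inequality and the curve norm derivative formula. Then, for $b\in\mathbb{R}$, the following statements are equivalent: (i) $\operatorname{osL}(f(t,\cdot))\le b$ on $C$ with respect to $[\![\cdot,\cdot]\!]$, for all $t\ge0$; (ii) $D^+\|\phi(t,t_0,x_0)-\phi(t,t_0,y_0)\|\le b\|\phi(t,t_0,x_0)-\phi(t,t_0,y_0)\|$ for all $x_0,y_0\in C$ and $0\le t_0\le t$ for which the solutions exist; (iii) $\|\phi(t,t_0,x_0)-\phi(t,t_0,y_0)\|\le e^{b(t-s)}\|\phi(s,t_0,x_0)-\phi(s,t_0,y_0)\|$ for all $x_0,y_0\in C$ and $0\le t_0\le s\le t$ for which the solutions exist. Moreover, if statements (i), (ii), (iii) hold, then solutions (starting in $C$) are unique. Finally, if statements (i), (ii), (iii) hold with $b<0$ and there exists $x^*\in\mathbb{R}^n$ such that $f(t,x^* )=0_n$ for all $t\ge0$, then solutions (starting in $C$) exist uniquely for all time $t\ge0$.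
   Context: A weak pairing on $\mathbb{R}^n$ is a map $[\![\cdot,\cdot]\!]:\mathbb{R}^n\times\mathbb{R}^n\to\mathbb{R}$ such that: (1) $[\![x_1+x_2,y]\!]\le[\![x_1,y]\!]+[\![x_2,y]\!]$ for all $x_1,x_2,y$, and it is continuous in its first argument; (2) $[\![\alpha x,y]\!]=[\![x,\alpha y]\!]=\alpha[\![x,y]\!]$ for all $x,y$ and all $\alpha\ge 0$, and $[\![-x,-y]\!]=[\![x,y]\!]$; (3) $[\![x,x]\!]>0$ for all $x\ne 0_n$; (4) $|[\![x,y]\!]|\le[\![x,x]\!]^{1/2}[\![y,y]\!]^{1/2}$ for all $x,y$. It is compatible with the norm $\|\cdot\|$ if $[\![x,x]\!]=\|x\|^2$ for all $x$. It satisfies Deimling's inequality if $[\![x,y]\!]\le\|y\|\lim_{h\to0^+}\frac{\|y+hx\|-\|y\|}{h}$ for all $x,y\in\mathbb{R}^n$. It satisfies the curve norm derivative formula if, for every differentiable $x:\,]a,b[\,\to\mathbb{R}^n$ and almost every $t\in\,]a,b[$, $\|x(t)\|D^+\|x(t)\|=[\![\dot x(t),x(t)]\!]$. Here $D^+\varphi(t)=\limsup_{h\to0^+}\frac{\varphi(t+h)-\varphi(t)}{h}$ is the upper right Dini derivative. For a map $g:C\to\mathbb{R}^n$, $\operatorname{osL}(g)=\sup_{x\ne y,\ x,y\in C}\frac{[\![g(x)-g(y),x-y]\!]}{\|x-y\|^2}\in\mathbb{R}\cup\{\infty\}$. $\phi(\cdot,t_0,x_0)$ denotes a solution of $\dot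 x=f(t,x)$ with $x(t_0)=x_0$; since $f$ is only continuous, solutions are not assumed unique a priori and statements about $\phi$ refer to any solutions with the given initial conditions. Forward invariance of $C$: solutions starting in $C$ remain in $C$. *)

theory Defs
  imports "HOL-Analysis.Analysis"
begin

text \<open>An arbitrary norm \<open>N\<close> on the space, in general different from the ambient (Euclidean)
  \<open>norm\<close>; the latter only supplies the standard topology and the notion of derivative.\<close>

definition is_norm :: "('a::euclidean_space \<Rightarrow> real) \<Rightarrow> bool" where
  "is_norm N \<longleftrightarrow>
     (\<forall>x. N x \<ge> 0) \<and> (\<forall>x. N x = 0 \<longleftrightarrow> x = 0) \<and>
     (\<forall>c x. N (c *\<^sub>R x) = \<bar>c\<bar> * N x) \<and>
     (\<forall>x y. N (x + y) \<le> N x + N y)"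

definition weak_pairing :: "('a::euclidean_space \<Rightarrow> 'a \<Rightarrow> real) \<Rightarrow> bool" where
  "weak_pairing W \<longleftrightarrow>
     (\<forall>x1 x2 y. W (x1 + x2) y \<le> W x1 y + W x2 y) \<and>
     (\<forall>y. continuous_on UNIV (\<lambda>x. W x y)) \<and>
     (\<forall>\<alpha> x y. \<alpha> \<ge> 0 \<longrightarrow> W (\<alpha> *\<^sub>R x) y = \<alpha> * W x y \<and> W x (\<alpha> *\<^sub>R y) = \<alpha> * W x y) \<and>
     (\<forall>x y. W (- x) (- y) = W x y) \<and>
     (\<forall>x. x \<noteq> 0 \<longrightarrow> W x x > 0) \<and>
     (\<forall>x y. \<bar>W x y\<bar> \<le> sqrt (W x x) * sqrt (W y y))"

definition compatible_pairing ::
    "('a::euclidean_space \<Rightarrow> real) \<Rightarrow> ('a \<Rightarrow> 'a \<Rightarrow> real) \<Rightarrow> bool" where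
  "compatible_pairing N W \<longleftrightarrow> (\<forall>x. W x x = (N x)\<^sup>2)"

text \<open>For a norm, the one-sided limit below exists for all \<open>x\<close> and \<open>y\<close> by convexity.\<close>

definition deimling ::
    "('a::euclidean_space \<Rightarrow> real) \<Rightarrow> ('a \<Rightarrow> 'a \<Rightarrow> real) \<Rightarrow> bool" where
  "deimling N W \<longleftrightarrow>
     (\<forall>x y. W x y \<le> N y * Lim (at_right 0) (\<lambda>h. (N (y + h *\<^sub>R x) - N y) / h))"

definition upper_right_dini :: "(real \<Rightarrow> real) \<Rightarrow> real \<Rightarrow> ereal" where
  "upper_right_dini \<phi> t = Limsup (at_right 0) (\<lambda>h. ereal ((\<phi> (t + h) - \<phi> t) / h))"

definition curve_norm_derivative_formula ::
    "('a::euclidean_space \<Rightarrow> real) \<Rightarrow> ('a \<Rightarrow> 'a \<Rightarrow> real) \<Rightarrow> bool" where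
  "curve_norm_derivative_formula N W \<longleftrightarrow>
     (\<forall>a b x x'. (\<forall>t\<in>{a<..<b}. (x has_vector_derivative x' t) (at t)) \<longrightarrow>
        (AE t\<in>{a<..<b} in lborel.
           ereal (N (x t)) * upper_right_dini (\<lambda>s. N (x s)) t = ereal (W (x' t) (x t))))"

definition osL :: "('a::euclidean_space \<Rightarrow> real) \<Rightarrow> ('a \<Rightarrow> 'a \<Rightarrow> real) \<Rightarrow> 'a set \<Rightarrow> ('a \<Rightarrow> 'a) \<Rightarrow> ereal"
  where "osL N W C g =
     (SUP (x, y)\<in>{(x, y). x \<in> C \<and> y \<in> C \<and> x \<noteq> y}. ereal (W (g x - g y) (x - y) / (N (x - y))\<^sup>2))"

text \<open>\<open>ode_solution f t0 x0 T \<phi>\<close>: on the nondegenerate half-open interval from \<open>t0\<close> (included) to \<open>T\<close>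
  (excluded, possibly \<open>\<infinity>\<close>), \<open>\<phi>\<close> solves the initial value problem \<open>x' = f(t, x)\<close>, \<open>x(t0) = x0\<close>,
  with a one-sided derivative at \<open>t0\<close>. Values of \<open>\<phi>\<close> elsewhere are irrelevant. Right-open intervals
  make the upper right Dini derivative meaningful at every time at which the solution exists.\<close>

abbreviation time_interval :: "real \<Rightarrow> ereal \<Rightarrow> real set" where
  "time_interval t0 T \<equiv> {t. t0 \<le> t \<and> ereal t < T}"

definition ode_solution ::
    "(real \<Rightarrow> 'a::euclidean_space \<Rightarrow> 'a) \<Rightarrow> real \<Rightarrow> 'a \<Rightarrow> ereal \<Rightarrow> (real \<Rightarrow> 'a) \<Rightarrow> bool" where
  "ode_solution f t0 x0 T \<phi> \<longleftrightarrow>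
     ereal t0 < T \<and> \<phi> t0 = x0 \<and>
     (\<forall>t\<in>time_interval t0 T.
        (\<phi> has_vector_derivative f t (\<phi> t)) (at t within time_interval t0 T))"

definition forward_invariant :: "(real \<Rightarrow> 'a::euclidean_space \<Rightarrow> 'a) \<Rightarrow> 'a set \<Rightarrow> bool" where
  "forward_invariant f C \<longleftrightarrow>
     (\<forall>t0\<ge>0. \<forall>x0\<in>C. \<forall>T \<phi>. ode_solution f t0 x0 T \<phi> \<longrightarrow> (\<forall>t\<in>time_interval t0 T. \<phi> t \<in> C))"

definition osL_condition ::
    "('a::euclidean_space \<Rightarrow> real) \<Rightarrow> ('a \<Rightarrow> 'a \<Rightarrow> real) \<Rightarrow> (real \<Rightarrow> 'a \<Rightarrow> 'a) \<Rightarrow> 'a set \<Rightarrow> real \<Rightarrow> bool"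
  where "osL_condition N W f C b \<longleftrightarrow> (\<forall>t\<ge>0. osL N W C (f t) \<le> ereal b)"

text \<open>In the next two conditions the two solutions may have different intervals of existence; the
  claims concern the times at which both exist.\<close>

definition dini_condition ::
    "('a::euclidean_space \<Rightarrow> real) \<Rightarrow> (real \<Rightarrow> 'a \<Rightarrow> 'a) \<Rightarrow> 'a set \<Rightarrow> real \<Rightarrow> bool"
  where "dini_condition N f C b \<longleftrightarrow>
     (\<forall>t0\<ge>0. \<forall>x0\<in>C. \<forall>y0\<in>C. \<forall>T1 T2 \<phi> \<psi>.
        ode_solution f t0 x0 T1 \<phi> \<and> ode_solution f t0 y0 T2 \<psi> \<longrightarrow>
        (\<forall>t. t0 \<le> t \<and> ereal t < T1 \<and> ereal t < T2 \<longrightarrow>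
           upper_right_dini (\<lambda>s. N (\<phi> s - \<psi> s)) t \<le> ereal (b * N (\<phi> t - \<psi> t))))"

definition incremental_condition ::
    "('a::euclidean_space \<Rightarrow> real) \<Rightarrow> (real \<Rightarrow> 'a \<Rightarrow> 'a) \<Rightarrow> 'a set \<Rightarrow> real \<Rightarrow> bool"
  where "incremental_condition N f C b \<longleftrightarrow>
     (\<forall>t0\<ge>0. \<forall>x0\<in>C. \<forall>y0\<in>C. \<forall>T1 T2 \<phi> \<psi>.
        ode_solution f t0 x0 T1 \<phi> \<and> ode_solution f t0 y0 T2 \<psi> \<longrightarrow>
        (\<forall>s t. t0 \<le> s \<and> s \<le> t \<and> ereal t < T1 \<and> ereal t < T2 \<longrightarrow>
           N (\<phi> t - \<psi> t) \<le> exp (b * (t - s)) * N (\<phi> s - \<psi> s)))"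

definition unique_solutions :: "(real \<Rightarrow> 'a::euclidean_space \<Rightarrow> 'a) \<Rightarrow> 'a set \<Rightarrow> bool" where
  "unique_solutions f C \<longleftrightarrow>
     (\<forall>t0\<ge>0. \<forall>x0\<in>C. \<forall>T1 T2 \<phi> \<psi>.
        ode_solution f t0 x0 T1 \<phi> \<and> ode_solution f t0 x0 T2 \<psi> \<longrightarrow>
        (\<forall>t. t0 \<le> t \<and> ereal t < T1 \<and> ereal t < T2 \<longrightarrow> \<phi> t = \<psi> t))"

end

theory Submission
  imports Defs "HOL-Complex_Analysis.Great_Picard"
begin

text \<open>
  The three conditions are linked by the directional derivative of the norm. For a norm \<open>N\<close> the
  quotients \<open>(N (z + h *\<^sub>R v) - N z) / h\<close> are nondecreasing in \<open>h > 0\<close>, so the right derivative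
  \<open>dir_deriv N z v\<close> exists, and the Dini derivative of \<open>N\<close> along any differentiable curve is its value
  at the velocity (\<open>upper_right_dini_norm_curve\<close>). Each condition is equivalent to the pointwise bound
  \<open>dir_deriv N (x - y) (f t x - f t y) \<le> b * N (x - y)\<close> on \<open>C\<close>, called \<open>growth_condition\<close>.

  Deimling's inequality makes the pairing at most \<open>N (x - y)\<close> times the directional derivative, so the
  growth condition implies \<open>osL_condition\<close>. Conversely, the curve norm derivative formula is applied to
  the difference of the straight lines that leave \<open>x\<close> and \<open>y\<close> with velocities \<open>f t x\<close> and \<open>f t y\<close>. It
  holds at arbitrarily small parameters, where convexity turns it into an upper bound for the
  directional derivative at the starting point (\<open>osL_imp_growth\<close>). In this way an almost-everywhere
  formula gives a bound at every pair of points.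

  The Dini derivative of the distance of two solutions is the directional derivative at their current
  states, so the growth condition implies \<open>dini_condition\<close>. To recover the growth condition from it,
  solutions must exist through every pair of initial states. Since \<open>f\<close> is merely continuous, this is
  Peano's theorem (\<open>peano_local\<close>), obtained from solutions of delay equations and the Arzela-Ascoli
  theorem. A Gronwall inequality for Dini derivatives (\<open>dini_gronwall\<close>) leads from \<open>dini_condition\<close> to
  \<open>incremental_condition\<close>; differentiating the exponential bound at \<open>h = 0\<close> leads back.

  Uniqueness is \<open>incremental_condition\<close> for equal initial values. For global existence with \<open>b < 0\<close>, the
  distance of a solution to its initial value \<open>x0\<close> grows at most at the rate \<open>N (f t x0)\<close>
  (\<open>a_priori_bound\<close>), which is bounded on bounded time intervals. Hence no solution can escape in finite
  time: solving the equation with states projected onto a large ball gives a solution on every bounded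
  interval, and by uniqueness these fit together.
\<close>

section \<open>One-sided directional derivatives of a norm\<close>

lemma is_normD:
  assumes "is_norm N"
  shows is_norm_nonneg: "N x \<ge> 0"
    and is_norm_eq_0: "N x = 0 \<longleftrightarrow> x = 0"
    and is_norm_scale: "N (c *\<^sub>R x) = \<bar>c\<bar> * N x"
    and is_norm_triangle: "N (x + y) \<le> N x + N y"
  using assms unfolding is_norm_def by auto

lemma is_norm_zero: "is_norm N \<Longrightarrow> N 0 = 0"
  by (simp add: is_norm_eq_0)

lemma is_norm_minus: "is_norm N \<Longrightarrow> N (- x) = N x"
  using is_norm_scale[of N "-1" x] by simp

lemma is_norm_diff_abs:
  assumes "is_norm N"
  shows "\<bar>N x - N y\<bar> \<le> N (x - y)"
  using is_norm_triangle[OF assms, of "x - y" y] is_norm_triangle[OF assms, of "y - x" x]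
    is_norm_minus[OF assms, of "x - y"] by simp

lemma is_norm_upper_bound:
  fixes N :: "'a::euclidean_space \<Rightarrow> real"
  assumes "is_norm N"
  obtains K where "K > 0" "\<And>x. N x \<le> K * norm x"
proof -
  let ?S = "\<Sum>b\<in>Basis. N (b::'a)"
  have fin: "N (\<Sum>b\<in>B. g b) \<le> (\<Sum>b\<in>B. N (g b))" if "finite B" for B :: "'a set" and g :: "'a \<Rightarrow> 'a"
    using that
  proof (induction B rule: finite_induct)
    case empty then show ?case by (simp add: is_norm_zero[OF assms])
  next
    case (insert b B)
    then show ?case using is_norm_triangle[OF assms, of "g b" "sum g B"] by simp
  qed
  have "N x \<le> (1 + ?S) * norm x" for x
  proof -
    have "N x = N (\<Sum>b\<in>Basis. (x \<bullet> b) *\<^sub>R b)" by (simp add: euclidean_representation)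
    also have "\<dots> \<le> (\<Sum>b\<in>Basis. N ((x \<bullet> b) *\<^sub>R b))" by (rule fin) simp
    also have "\<dots> = (\<Sum>b\<in>Basis. \<bar>x \<bullet> b\<bar> * N b)" by (simp add: is_norm_scale[OF assms])
    also have "\<dots> \<le> (\<Sum>b\<in>Basis. norm x * N b)"
      by (intro sum_mono mult_right_mono Basis_le_norm is_norm_nonneg[OF assms])
    also have "\<dots> = ?S * norm x" by (simp add: sum_distrib_left mult.commute)
    finally show ?thesis using norm_ge_zero[of x] by (simp only: distrib_right)
  qed
  moreover have "1 + ?S > 0"
    by (simp add: add_pos_nonneg sum_nonneg is_norm_nonneg[OF assms])
  ultimately show ?thesis using that by blast
qed

lemma is_norm_continuous_on:
  fixes N :: "'a::euclidean_space \<Rightarrow> real"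
  assumes "is_norm N"
  shows "continuous_on S N"
proof -
  obtain K where K: "K > 0" "\<And>x. N x \<le> K * norm x" using is_norm_upper_bound[OF assms] by blast
  show ?thesis unfolding continuous_on_iff
  proof (intro ballI allI impI)
    fix e :: real and y assume e: "(0::real) < e"
    show "\<exists>d>0. \<forall>x'\<in>S. dist x' y < d \<longrightarrow> dist (N x') (N y) < e"
      by (rule exI[of _ "e / K"])
         (use e K is_norm_diff_abs[OF assms] in
          \<open>auto simp: dist_norm field_simps intro: le_less_trans[OF order_trans]\<close>)
  qed
qed

lemma is_norm_tendsto:
  fixes N :: "'a::euclidean_space \<Rightarrow> real"
  assumes "is_norm N" "(g \<longlongrightarrow> l) F"
  shows "((\<lambda>x. N (g x)) \<longlongrightarrow> N l) F"
  using continuous_on_tendsto_compose[OF is_norm_continuous_on[OF assms(1), of UNIV] assms(2)] by simp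

text \<open>Equivalence with the Euclidean norm, by minimising \<open>N\<close> over the compact unit sphere. It turns
  a priori bounds in \<open>N\<close> into compact sets of states.\<close>
lemma is_norm_lower_bound:
  fixes N :: "'a::euclidean_space \<Rightarrow> real"
  assumes "is_norm N"
  obtains k where "k > 0" "\<And>x. k * norm x \<le> N x"
proof -
  obtain u :: 'a where u: "u \<in> sphere 0 1" "\<And>x. x \<in> sphere 0 1 \<Longrightarrow> N u \<le> N x"
    using continuous_attains_inf[OF compact_sphere _ is_norm_continuous_on[OF assms], of 0 1]
    by (metis sphere_eq_empty not_one_less_zero)
  have "N u > 0"
    using u(1) is_norm_nonneg[OF assms, of u] is_norm_eq_0[OF assms, of u] by auto
  moreover have "N u * norm x \<le> N x" for x
  proof (cases "x = 0")
    case False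
    then have "N u \<le> N ((1 / norm x) *\<^sub>R x)" by (intro u(2)) simp
    then show ?thesis using False by (simp add: is_norm_scale[OF assms] field_simps)
  qed (simp add: is_norm_zero[OF assms])
  ultimately show ?thesis using that by blast
qed

text \<open>The right derivative of \<open>N\<close> at \<open>z\<close> in direction \<open>v\<close>, the quantity that Deimling's inequality
  compares with the pairing.\<close>
definition dir_deriv :: "('a::euclidean_space \<Rightarrow> real) \<Rightarrow> 'a \<Rightarrow> 'a \<Rightarrow> real" where
  "dir_deriv N z v = Lim (at_right 0) (\<lambda>h. (N (z + h *\<^sub>R v) - N z) / h)"

text \<open>Convexity: \<open>z + s *\<^sub>R v\<close> lies on the segment from \<open>z\<close> to \<open>z + t *\<^sub>R v\<close>.\<close>
lemma norm_quotient_mono: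
  assumes "is_norm N" "0 < s" "s \<le> t"
  shows "(N (z + s *\<^sub>R v) - N z) / s \<le> (N (z + t *\<^sub>R v) - N z) / t"
proof -
  define l where "l = s / t"
  have l: "0 \<le> l" "l \<le> 1" "l * t = s" using assms by (auto simp: l_def)
  have "z + s *\<^sub>R v = (1 - l) *\<^sub>R z + l *\<^sub>R (z + t *\<^sub>R v)"
    by (simp add: algebra_simps flip: l(3))
  then have "N (z + s *\<^sub>R v) \<le> (1 - l) * N z + l * N (z + t *\<^sub>R v)"
    using is_norm_triangle[OF assms(1), of "(1 - l) *\<^sub>R z" "l *\<^sub>R (z + t *\<^sub>R v)"] l
    by (simp add: is_norm_scale[OF assms(1)])
  then have "N (z + s *\<^sub>R v) - N z \<le> l * (N (z + t *\<^sub>R v) - N z)" by (simp add: algebra_simps)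
  then show ?thesis using assms by (simp add: l_def field_simps)
qed

text \<open>A monotone quotient that is bounded below by \<open>- N v\<close> converges to its infimum. Hence the one-sided
  limit exists, and it lies below every single quotient.\<close>
lemma norm_quotient_tendsto_Inf:
  fixes z v :: "'a::euclidean_space"
  assumes "is_norm N"
  defines "q \<equiv> \<lambda>h::real. (N (z + h *\<^sub>R v) - N z) / h"
  shows "(q \<longlongrightarrow> Inf (q ` {0<..})) (at_right 0)" and "0 < h \<Longrightarrow> Inf (q ` {0<..}) \<le> q h"
proof -
  have "- N v \<le> q h" if "h > 0" for h
    using is_norm_triangle[OF assms(1), of "z + h *\<^sub>R v" "- (h *\<^sub>R v)"] that
    by (simp add: q_def is_norm_minus[OF assms(1)] is_norm_scale[OF assms(1)] field_simps)
  then have bdd: "bdd_below (q ` {0<..})" by (intro bdd_belowI[of _ "- N v"]) auto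
  then show le: "0 < h \<Longrightarrow> Inf (q ` {0<..}) \<le> q h" for h by (intro cInf_lower) auto
  show "(q \<longlongrightarrow> Inf (q ` {0<..})) (at_right 0)"
  proof (rule order_tendstoI)
    fix a assume "a < Inf (q ` {0<..})"
    then show "eventually (\<lambda>h. a < q h) (at_right 0)"
      using le by (auto simp: eventually_at_right_field intro!: exI[of _ 1] intro: less_le_trans)
  next
    fix a assume "Inf (q ` {0<..}) < a"
    then obtain t where "t > 0" "q t < a"
      using cInf_less_iff[of "q ` {0<..}" a] bdd by auto
    then show "eventually (\<lambda>h. q h < a) (at_right 0)"
      using norm_quotient_mono[OF assms(1), of _ t z v]
      unfolding eventually_at_right_field q_def by (meson le_less_trans less_imp_le)
  qed
qed

lemma dir_deriv_eq_Inf: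
  assumes "is_norm N"
  shows "dir_deriv N z v = Inf ((\<lambda>h. (N (z + h *\<^sub>R v) - N z) / h) ` {0<..})"
  unfolding dir_deriv_def
  by (rule tendsto_Lim[OF _ norm_quotient_tendsto_Inf(1)[OF assms]]) simp

lemma dir_deriv_tendsto:
  assumes "is_norm N"
  shows "((\<lambda>h. (N (z + h *\<^sub>R v) - N z) / h) \<longlongrightarrow> dir_deriv N z v) (at_right 0)"
  unfolding dir_deriv_eq_Inf[OF assms] by (rule norm_quotient_tendsto_Inf(1)[OF assms])

lemma dir_deriv_le_quotient:
  assumes "is_norm N" "h > 0"
  shows "dir_deriv N z v \<le> (N (z + h *\<^sub>R v) - N z) / h"
  unfolding dir_deriv_eq_Inf[OF assms(1)] by (rule norm_quotient_tendsto_Inf(2)[OF assms])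

lemma dir_deriv_add_le:
  assumes "is_norm N"
  shows "dir_deriv N z (v + w) \<le> dir_deriv N z v + N w"
proof (rule tendsto_le[OF _ tendsto_add[OF dir_deriv_tendsto[OF assms] tendsto_const]
      dir_deriv_tendsto[OF assms]])
  show "\<forall>\<^sub>F h in at_right 0. (N (z + h *\<^sub>R (v + w)) - N z) / h \<le> (N (z + h *\<^sub>R v) - N z) / h + N w"
    unfolding eventually_at_right_field
  proof (intro exI[of _ 1] conjI allI impI)
    fix h :: real assume "0 < h" "h < 1"
    then show "(N (z + h *\<^sub>R (v + w)) - N z) / h \<le> (N (z + h *\<^sub>R v) - N z) / h + N w"
      using is_norm_triangle[OF assms, of "z + h *\<^sub>R v" "h *\<^sub>R w"]
      by (simp add: is_norm_scale[OF assms] field_simps)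
  qed simp
qed simp

text \<open>Chain rule: near \<open>t\<close> a curve differs from its tangent by \<open>o(h)\<close>, and \<open>N\<close> is Lipschitz with respect
  to itself, so the Dini derivative along the curve is the directional derivative in the direction of
  the velocity, at every time and as a true limit. This replaces the almost-everywhere
  statement of the curve norm derivative formula wherever a solution is concerned.\<close>
lemma upper_right_dini_norm_curve:
  fixes c :: "real \<Rightarrow> 'a::euclidean_space"
  assumes "is_norm N" and "(c has_vector_derivative d) (at_right t)"
  shows "((\<lambda>h. (N (c (t + h)) - N (c t)) / h) \<longlongrightarrow> dir_deriv N (c t) d) (at_right 0)"
    and "upper_right_dini (\<lambda>s. N (c s)) t = ereal (dir_deriv N (c t) d)"
proof -
  define r where "r h = (c (t + h) - c t) /\<^sub>R h - d" for h
  have "((\<lambda>s. (c s - c t) /\<^sub>R (s - t)) \<longlongrightarrow> d) (at_right t)"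
  proof (rule LIM_zero_cancel, rule tendsto_norm_zero_cancel, rule Lim_transform_eventually)
    show "((\<lambda>s. norm (c s - c t - (s - t) *\<^sub>R d) / norm (s - t)) \<longlongrightarrow> 0) (at_right t)"
      using assms(2) by (simp add: has_vector_derivative_def has_derivative_iff_norm)
    show "\<forall>\<^sub>F s in at_right t. norm (c s - c t - (s - t) *\<^sub>R d) / norm (s - t)
        = norm ((c s - c t) /\<^sub>R (s - t) - d)"
      unfolding eventually_at_right_field
    proof (intro exI[of _ "t + 1"] conjI allI impI)
      fix s assume "t < s" "s < t + 1"
      then have "(c s - c t) /\<^sub>R (s - t) - d = (c s - c t - (s - t) *\<^sub>R d) /\<^sub>R (s - t)"
        by (simp add: scaleR_diff_right)
      then show "norm (c s - c t - (s - t) *\<^sub>R d) / norm (s - t)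
          = norm ((c s - c t) /\<^sub>R (s - t) - d)"
        by (simp add: divide_inverse_commute)
    qed simp
  qed
  then have "((\<lambda>h. (c (t + h) - c t) /\<^sub>R h) \<longlongrightarrow> d) (at_right 0)"
    by (subst (asm) filterlim_at_right_to_0) (simp add: add.commute)
  then have r0: "((\<lambda>h. N (r h)) \<longlongrightarrow> 0) (at_right 0)"
    using is_norm_tendsto[OF assms(1), of "r" 0] unfolding r_def
    by (simp add: LIM_zero is_norm_zero[OF assms(1)])
  let ?q = "\<lambda>h. (N (c t + h *\<^sub>R d) - N (c t)) / h"
  have diff0: "((\<lambda>h. (N (c (t + h)) - N (c t)) / h - ?q h) \<longlongrightarrow> 0) (at_right 0)"
  proof (rule Lim_null_comparison[OF _ r0])
    show "\<forall>\<^sub>F h in at_right 0. norm ((N (c (t + h)) - N (c t)) / h - ?q h) \<le> N (r h)"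
      unfolding eventually_at_right_field
    proof (intro exI[of _ 1] conjI allI impI)
      fix h :: real assume h: "0 < h" "h < 1"
      have "c (t + h) - (c t + h *\<^sub>R d) = h *\<^sub>R r h"
        using h by (simp add: r_def algebra_simps)
      then have "\<bar>N (c (t + h)) - N (c t + h *\<^sub>R d)\<bar> \<le> h * N (r h)"
        using is_norm_diff_abs[OF assms(1), of "c (t + h)" "c t + h *\<^sub>R d"] h
        by (simp add: is_norm_scale[OF assms(1)])
      moreover have "(N (c (t + h)) - N (c t)) / h - ?q h = (N (c (t + h)) - N (c t + h *\<^sub>R d)) / h"
        by (simp add: diff_divide_distrib)
      ultimately show "norm ((N (c (t + h)) - N (c t)) / h - ?q h) \<le> N (r h)"
        using h by (simp add: field_simps)
    qed simp
  qed
  show lim: "((\<lambda>h. (N (c (t + h)) - N (c t)) / h) \<longlongrightarrow> dir_deriv N (c t) d) (at_right 0)"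
    using tendsto_add[OF diff0 dir_deriv_tendsto[OF assms(1), of "c t" d]] by simp
  then show "upper_right_dini (\<lambda>s. N (c s)) t = ereal (dir_deriv N (c t) d)"
    unfolding upper_right_dini_def by (intro lim_imp_Limsup tendsto_ereal) simp_all
qed

section \<open>The one-sided Lipschitz condition as a bound on directional derivatives\<close>

text \<open>The pairing-free form of the one-sided Lipschitz condition, and the pivot of the equivalence:
  the right derivative of \<open>N (x - y)\<close> when \<open>x\<close> and \<open>y\<close> move with the velocities that \<open>f\<close> assigns to them.\<close>
definition growth_condition ::
    "('a::euclidean_space \<Rightarrow> real) \<Rightarrow> (real \<Rightarrow> 'a \<Rightarrow> 'a) \<Rightarrow> 'a set \<Rightarrow> real \<Rightarrow> bool" where
  "growth_condition N f C b \<longleftrightarrow>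
     (\<forall>t\<ge>0. \<forall>x\<in>C. \<forall>y\<in>C. dir_deriv N (x - y) (f t x - f t y) \<le> b * N (x - y))"

lemma weak_pairingD:
  assumes "weak_pairing W"
  shows weak_pairing_add: "W (x1 + x2) y \<le> W x1 y + W x2 y"
    and weak_pairing_cauchy_schwarz: "\<bar>W x y\<bar> \<le> sqrt (W x x) * sqrt (W y y)"
  using assms unfolding weak_pairing_def by auto

lemma pairing_le_norms:
  assumes "is_norm N" "weak_pairing W" "compatible_pairing N W"
  shows "W x y \<le> N x * N y"
  using weak_pairing_cauchy_schwarz[OF assms(2), of x y] assms(3) is_norm_nonneg[OF assms(1)]
  by (simp add: compatible_pairing_def real_sqrt_abs)

lemma osL_le_iff:
  assumes "is_norm N"
  shows "osL N W C g \<le> ereal b \<longleftrightarrow> (\<forall>x\<in>C. \<forall>y\<in>C. x \<noteq> y \<longrightarrow> W (g x - g y) (x - y) \<le> b * (N (x - y))\<^sup>2)"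
proof -
  have "N (x - y) > 0" if "x \<noteq> y" for x y
    using that is_norm_nonneg[OF assms, of "x - y"] is_norm_eq_0[OF assms, of "x - y"] by simp
  then show ?thesis
    unfolding osL_def SUP_le_iff by (fastforce simp: pos_divide_le_eq)
qed

lemma dir_deriv_zero:
  assumes "is_norm N"
  shows "dir_deriv N z 0 = 0"
  unfolding dir_deriv_def by (simp add: tendsto_Lim)

text \<open>The curve norm derivative formula, applied to a straight line through \<open>z\<close>, yields at some arbitrarily
  small parameter \<open>s\<close> a bound by the pairing for the difference quotient that starts at \<open>z\<close>, not only for
  the derivative at \<open>s\<close>: by convexity the slope between \<open>0\<close> and \<open>s\<close> is at most the right derivative at \<open>s\<close>.\<close>
lemma quotient_le_pairing_on_line:
  fixes z v :: "'a::euclidean_space"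
  assumes N: "is_norm N" and cndf: "curve_norm_derivative_formula N W" and "\<delta> > 0"
    and pos: "\<And>s. 0 < s \<Longrightarrow> s < \<delta> \<Longrightarrow> N (z + s *\<^sub>R v) > 0"
  obtains s where "0 < s" "s < \<delta>"
    "N (z + s *\<^sub>R v) * ((N (z + s *\<^sub>R v) - N z) / s) \<le> W v (z + s *\<^sub>R v)"
proof -
  define c where "c s = z + s *\<^sub>R v" for s :: real
  have der: "(c has_vector_derivative v) (at s)" for s
    unfolding c_def by (auto intro!: derivative_eq_intros)
  then have ae: "AE s\<in>{0<..<\<delta>} in lborel.
      ereal (N (c s)) * upper_right_dini (\<lambda>s. N (c s)) s = ereal (W v (c s))"
    using cndf[unfolded curve_norm_derivative_formula_def, rule_format, of 0 \<delta> c "\<lambda>_. v"] by simp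
  \<comment> \<open>The interval has positive measure, so an almost-everywhere statement holds somewhere on it.\<close>
  have "\<exists>s\<in>{0<..<\<delta>}. ereal (N (c s)) * upper_right_dini (\<lambda>s. N (c s)) s = ereal (W v (c s))"
  proof (rule ccontr)
    assume "\<not> ?thesis"
    with ae have "AE s in lborel. s \<notin> {0<..<\<delta>}" by (auto elim: eventually_mono)
    then have "{0<..<\<delta>} \<in> null_sets lborel" using AE_iff_null_sets[of "{0<..<\<delta>}" lborel] by simp
    then show False using \<open>\<delta> > 0\<close> by (simp add: null_sets_def)
  qed
  then obtain s where s: "0 < s" "s < \<delta>"
    and eq: "ereal (N (c s)) * upper_right_dini (\<lambda>s. N (c s)) s = ereal (W v (c s))" by auto
  have "(N (c s) - N z) / s \<le> (N (c (s + h)) - N (c s)) / h" if "h > 0" for h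
  proof -
    have "(N (c s) - N z) / s \<le> (N (c (s + h)) - N z) / (s + h)"
      using norm_quotient_mono[OF N, of s "s + h" z v] s that by (simp add: c_def)
    then show ?thesis using s that by (simp add: field_simps)
  qed
  then have "\<forall>\<^sub>F h in at_right 0. (N (c s) - N z) / s \<le> (N (c (s + h)) - N (c s)) / h"
    by (auto simp: eventually_at_right_field intro!: exI[of _ 1])
  then have "(N (c s) - N z) / s \<le> dir_deriv N (c s) v"
    using tendsto_lowerbound[OF upper_right_dini_norm_curve(1)[OF N has_vector_derivative_at_within[OF der]]]
    by simp
  then have "N (c s) * ((N (c s) - N z) / s) \<le> N (c s) * dir_deriv N (c s) v"
    by (intro mult_left_mono is_norm_nonneg[OF N])
  also have "\<dots> = W v (c s)"
    using eq upper_right_dini_norm_curve(2)[OF N has_vector_derivative_at_within[OF der], of s] by simp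
  finally show ?thesis using that[OF s] by (simp add: c_def)
qed

text \<open>Deimling's inequality bounds the pairing from above by the directional derivative, which is the wrong direction
  here; and the curve norm derivative formula gives equality only at almost every point of a curve. The
  way out is to move \<open>x\<close> and \<open>y\<close> along straight lines with the constant velocities \<open>f t x\<close> and \<open>f t y\<close>.
  If \<open>xs s\<close> and \<open>ys s\<close> are the displaced points, then at a suitable small \<open>s\<close> the difference quotient of
  \<open>N\<close> along their difference is at most
  \<open>W v (xs s - ys s) / N (xs s - ys s)\<close> with \<open>v = f t x - f t y\<close>. Subadditivity of \<open>W\<close> in its first argument
  replaces \<open>v\<close> by the velocity difference at the displaced points, where the one-sided Lipschitz bound
  applies; the cost of this exchange vanishes as \<open>s\<close> tends to \<open>0\<close>, by continuity of \<open>f t\<close>.\<close>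
lemma osL_imp_growth:
  fixes f :: "real \<Rightarrow> 'a::euclidean_space \<Rightarrow> 'a"
  assumes cont: "continuous_on UNIV (f t)" and "open C"
    and N: "is_norm N" and W: "weak_pairing W" "compatible_pairing N W"
    and cndf: "curve_norm_derivative_formula N W"
    and osL: "osL N W C (f t) \<le> ereal b" and x: "x \<in> C" and y: "y \<in> C"
  shows "dir_deriv N (x - y) (f t x - f t y) \<le> b * N (x - y)"
proof (cases "x = y")
  case True
  then show ?thesis by (simp add: dir_deriv_zero[OF N] is_norm_zero[OF N])
next
  case False
  define g where "g = f t"
  define v where "v = g x - g y"
  define z where "z = x - y"
  define xs ys where "xs s = x + s *\<^sub>R g x" and "ys s = y + s *\<^sub>R g y" for s :: real
  define R where "R s = N (v - (g (xs s) - g (ys s))) + b * N (z + s *\<^sub>R v)" for s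
  \<comment> \<open>\<open>R s\<close> is the resulting bound for the difference quotient at \<open>s\<close>.\<close>
  have line: "xs s - ys s = z + s *\<^sub>R v" for s
    by (simp add: xs_def ys_def z_def v_def algebra_simps)
  have lim_xs: "(xs \<longlongrightarrow> x) (at_right 0)" and lim_ys: "(ys \<longlongrightarrow> y) (at_right 0)"
    unfolding xs_def ys_def by (auto intro!: tendsto_eq_intros)
  have lim_zs: "((\<lambda>s. z + s *\<^sub>R v) \<longlongrightarrow> z) (at_right 0)"
    by (auto intro!: tendsto_eq_intros)
  have lim_g: "((\<lambda>s. g (h s)) \<longlongrightarrow> g l) (at_right 0)" if "(h \<longlongrightarrow> l) (at_right 0)" for h l
    using continuous_on_tendsto_compose[OF cont that] by (simp add: g_def)
  have "((\<lambda>s. v - (g (xs s) - g (ys s))) \<longlongrightarrow> v - (g x - g y)) (at_right 0)"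
    by (intro tendsto_intros lim_g lim_xs lim_ys)
  from is_norm_tendsto[OF N this]
  have lim_N: "((\<lambda>s. N (v - (g (xs s) - g (ys s)))) \<longlongrightarrow> N 0) (at_right 0)"
    by (simp add: v_def)
  have "(R \<longlongrightarrow> N 0 + b * N z) (at_right 0)"
    unfolding R_def by (intro tendsto_add[OF lim_N] tendsto_mult[OF tendsto_const] is_norm_tendsto[OF N] lim_zs)
  then have lim_R: "(R \<longlongrightarrow> b * N z) (at_right 0)" by (simp add: is_norm_zero[OF N])
  have N_pos: "N u > 0 \<longleftrightarrow> u \<noteq> 0" for u
    using is_norm_nonneg[OF N, of u] is_norm_eq_0[OF N, of u] by linarith
  have "N z > 0" using False by (simp add: N_pos z_def)
  have good: "\<forall>\<^sub>F s in at_right 0. xs s \<in> C \<and> ys s \<in> C \<and> N (z + s *\<^sub>R v) > 0"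
    using topological_tendstoD[OF lim_xs \<open>open C\<close> x] topological_tendstoD[OF lim_ys \<open>open C\<close> y]
      order_tendstoD(1)[OF is_norm_tendsto[OF N lim_zs] \<open>N z > 0\<close>]
    by eventually_elim simp
  show ?thesis
  proof (rule field_le_epsilon)
    fix e :: real assume "e > 0"
    have "\<forall>\<^sub>F s in at_right 0. R s < b * N z + e"
      by (rule order_tendstoD(2)[OF lim_R]) (use \<open>e > 0\<close> in simp)
    with good have "\<forall>\<^sub>F s in at_right 0.
        (xs s \<in> C \<and> ys s \<in> C \<and> N (z + s *\<^sub>R v) > 0) \<and> R s < b * N z + e"
      by eventually_elim simp
    then obtain \<delta> where "\<delta> > 0" and \<delta>: "\<And>s. 0 < s \<Longrightarrow> s < \<delta> \<Longrightarrow>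
        (xs s \<in> C \<and> ys s \<in> C \<and> N (z + s *\<^sub>R v) > 0) \<and> R s < b * N z + e"
      unfolding eventually_at_right_field by blast
    obtain s where s: "0 < s" "s < \<delta>"
      and W_ge: "N (z + s *\<^sub>R v) * ((N (z + s *\<^sub>R v) - N z) / s) \<le> W v (z + s *\<^sub>R v)"
      using quotient_le_pairing_on_line[OF N cndf \<open>\<delta> > 0\<close>, of z v] \<delta> by blast
    let ?u = "z + s *\<^sub>R v" and ?w = "g (xs s) - g (ys s)"
    have pos: "N ?u > 0" using \<delta>[OF s] by blast
    have "W v ?u \<le> W (v - ?w) ?u + W ?w ?u"
      using weak_pairing_add[OF W(1), of "v - ?w" ?w ?u] by simp
    also have "W (v - ?w) ?u \<le> N ?u * N (v - ?w)"
      using pairing_le_norms[OF N W, of "v - ?w" ?u] by (simp add: mult.commute)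
    also have "W ?w ?u \<le> N ?u * (b * N ?u)"
      using osL \<delta>[OF s] pos is_norm_zero[OF N] unfolding osL_le_iff[OF N]
      by (simp add: g_def[symmetric] line[symmetric] power2_eq_square mult_ac) (metis diff_self less_irrefl)
    finally have "W v ?u \<le> N ?u * R s" by (simp add: R_def distrib_left)
    with W_ge pos have "(N ?u - N z) / s \<le> R s"
      using mult_le_cancel_left_pos order_trans by blast
    with dir_deriv_le_quotient[OF N \<open>0 < s\<close>, of z v] \<delta>[OF s]
    have "dir_deriv N z v \<le> b * N z + e" by linarith
    then show "dir_deriv N (x - y) (f t x - f t y) \<le> b * N (x - y) + e"
      by (simp add: z_def v_def g_def)
  qed
qed

lemma osL_condition_iff_growth:
  fixes f :: "real \<Rightarrow> 'a::euclidean_space \<Rightarrow> 'a"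
  assumes "\<And>t. t \<ge> 0 \<Longrightarrow> continuous_on UNIV (f t)" and "open C"
    and N: "is_norm N" and "weak_pairing W" "compatible_pairing N W"
    and "deimling N W" and "curve_norm_derivative_formula N W"
  shows "osL_condition N W f C b \<longleftrightarrow> growth_condition N f C b"
proof
  assume "osL_condition N W f C b"
  then show "growth_condition N f C b"
    using osL_imp_growth[where f = f] assms unfolding osL_condition_def growth_condition_def by blast
next
  assume growth: "growth_condition N f C b"
  show "osL_condition N W f C b"
    unfolding osL_condition_def osL_le_iff[OF N]
  proof (intro allI ballI impI)
    fix t :: real and x y assume "0 \<le> t" "x \<in> C" "y \<in> C"
    have "W (f t x - f t y) (x - y) \<le> N (x - y) * dir_deriv N (x - y) (f t x - f t y)"
      using \<open>deimling N W\<close> by (simp add: deimling_def dir_deriv_def)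
    also have "\<dots> \<le> N (x - y) * (b * N (x - y))"
      using growth \<open>0 \<le> t\<close> \<open>x \<in> C\<close> \<open>y \<in> C\<close>
      by (intro mult_left_mono is_norm_nonneg[OF N]) (simp add: growth_condition_def)
    finally show "W (f t x - f t y) (x - y) \<le> b * (N (x - y))\<^sup>2"
      by (simp add: power2_eq_square mult_ac)
  qed
qed

section \<open>Comparison lemmas for Dini derivatives\<close>

lemma upper_right_dini_less_imp:
  assumes "upper_right_dini w t < ereal k"
  shows "\<forall>\<^sub>F h in at_right 0. w (t + h) < w t + k * h"
proof -
  have "\<forall>\<^sub>F h in at_right 0. ereal ((w (t + h) - w t) / h) < ereal k"
    using assms unfolding upper_right_dini_def by (rule Limsup_lessD)
  moreover have "\<forall>\<^sub>F h::real in at_right 0. 0 < h" by (rule eventually_at_right_less)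
  ultimately show ?thesis by eventually_elim (simp add: field_simps)
qed

text \<open>Subtracting the line of slope \<open>k\<close> leaves a function that does not increase to the right of any
  point. If it ended above its initial value, it could be continued at or below that value from the last
  time at which it is there.\<close>
lemma right_growth_comparison:
  fixes w :: "real \<Rightarrow> real"
  assumes "a \<le> c" and cont: "continuous_on {a..c} w"
    and growth: "\<And>t. t \<in> {a..<c} \<Longrightarrow> \<forall>\<^sub>F h in at_right 0. w (t + h) \<le> w t + k * h"
  shows "w c \<le> w a + k * (c - a)"
proof (rule ccontr)
  define v where "v t = w t - k * t" for t
  define S where "S = {a..c} \<inter> v -` {..v a}"
  assume "\<not> ?thesis"
  then have "v c > v a" by (simp add: v_def algebra_simps)
  have "continuous_on {a..c} v" unfolding v_def by (intro continuous_intros cont)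
  then have "closed S" unfolding S_def by (intro continuous_closed_preimage) auto
  then have "compact S" by (simp add: compact_eq_bounded_closed S_def bounded_Int)
  moreover have "a \<in> S" using \<open>a \<le> c\<close> by (simp add: S_def)
  ultimately obtain \<tau> where \<tau>: "\<tau> \<in> S" "\<And>t. t \<in> S \<Longrightarrow> t \<le> \<tau>"
    using compact_attains_sup[of S] by blast
  have "\<tau> \<in> {a..<c}" using \<tau>(1) \<open>v c > v a\<close> by (auto simp: S_def less_le)
  from growth[OF this] obtain d where "d > 0" and d: "\<And>h. 0 < h \<Longrightarrow> h < d \<Longrightarrow> w (\<tau> + h) \<le> w \<tau> + k * h"
    unfolding eventually_at_right_field by blast
  define h where "h = min (d / 2) (c - \<tau>)"
  have h: "0 < h" "h < d" "\<tau> + h \<le> c" using \<open>d > 0\<close> \<open>\<tau> \<in> {a..<c}\<close> by (auto simp: h_def)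
  have "v (\<tau> + h) \<le> v \<tau>" using d[OF h(1,2)] by (simp add: v_def algebra_simps)
  then have "\<tau> + h \<in> S" using \<tau>(1) h by (auto simp: S_def)
  then show False using \<tau>(2) h(1) by fastforce
qed

text \<open>With \<open>w t = exp (- b * t) * u t\<close>, the hypothesis says that the upper right derivative of \<open>w\<close> is at most
  \<open>0\<close>, hence below every \<open>e > 0\<close>.\<close>
lemma dini_gronwall:
  fixes u :: "real \<Rightarrow> real"
  assumes "a \<le> c" and cont: "continuous_on {a..c} u"
    and dini: "\<And>t. t \<in> {a..<c} \<Longrightarrow> upper_right_dini u t \<le> ereal (b * u t)"
  shows "u c \<le> exp (b * (c - a)) * u a"
proof -
  define w where "w t = exp (- b * t) * u t" for t
  have cont_w: "continuous_on {a..c} w" unfolding w_def by (intro continuous_intros cont)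
  have "w c \<le> w a + e * (c - a)" if "e > 0" for e
  proof (rule right_growth_comparison[OF \<open>a \<le> c\<close> cont_w])
    fix t assume t: "t \<in> {a..<c}"
    \<comment> \<open>\<open>w (t + h)\<close> lies below \<open>exp (- b * t) * F h\<close>, and the slope of this bound at \<open>h = 0\<close> is \<open>e / 2 < e\<close>.\<close>
    define k where "k = b * u t + e * exp (b * t) / 2"
    define F where "F h = exp (- b * h) * (u t + k * h)" for h
    have "upper_right_dini u t < ereal k"
      by (rule le_less_trans[OF dini[OF t]]) (use that in \<open>simp add: k_def\<close>)
    from upper_right_dini_less_imp[OF this]
    have u: "\<forall>\<^sub>F h in at_right 0. u (t + h) < u t + k * h" .
    have "(F has_real_derivative e * exp (b * t) / 2) (at_right 0)"
      unfolding F_def by (auto intro!: derivative_eq_intros simp: k_def)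
    then have "((\<lambda>h. (F h - F 0) / (h - 0)) \<longlongrightarrow> e * exp (b * t) / 2) (at_right 0)"
      by (simp add: has_field_derivative_iff)
    then have "\<forall>\<^sub>F h in at_right 0. (F h - F 0) / (h - 0) < e * exp (b * t)"
      by (rule order_tendstoD(2)) (use that in simp)
    with u eventually_at_right_less[of "0::real"]
    show "\<forall>\<^sub>F h in at_right 0. w (t + h) \<le> w t + e * h"
    proof eventually_elim
      case (elim h)
      have "w (t + h) \<le> exp (- b * (t + h)) * (u t + k * h)"
        unfolding w_def using elim(1) by (intro mult_left_mono) auto
      also have "\<dots> = exp (- b * t) * F h"
        by (simp add: F_def exp_add[symmetric] algebra_simps flip: exp_add)
      also have "\<dots> \<le> exp (- b * t) * (F 0 + e * exp (b * t) * h)"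
        using elim(2,3) by (intro mult_left_mono) (auto simp: field_simps)
      also have "\<dots> = w t + e * h"
        by (simp add: F_def w_def distrib_left exp_minus)
      finally show ?case .
    qed
  qed
  then have "w c \<le> w a + e" if "e > 0" for e
  proof -
    have "w c \<le> w a + e / (c - a + 1) * (c - a)" 
      using \<open>\<And>e. 0 < e \<Longrightarrow> w c \<le> w a + e * (c - a)\<close>[of "e / (c - a + 1)"] that \<open>a \<le> c\<close> by simp
    also have "e / (c - a + 1) * (c - a) \<le> e" using that \<open>a \<le> c\<close> by (simp add: field_simps)
    finally show ?thesis by simp
  qed
  then have "w c \<le> w a" by (rule field_le_epsilon)
  then have "exp (b * c) * w c \<le> exp (b * c) * w a" by (intro mult_left_mono) auto
  then show ?thesis
    by (simp add: w_def right_diff_distrib exp_diff exp_minus field_simps)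
qed

section \<open>Peano's existence theorem\<close>

text \<open>Tonelli's approximation: the right-hand side is evaluated at the state of time \<open>d\<close> earlier. Iterating
  the integral operator from the constant \<open>x0\<close> then makes the solution exact on one more interval of
  length \<open>d\<close> per step, so finitely many iterations reach \<open>t1\<close>. The Lipschitz constant \<open>M\<close> does not
  depend on \<open>d\<close>.\<close>
lemma delayed_solution:
  fixes F :: "real \<Rightarrow> 'a::euclidean_space \<Rightarrow> 'a"
  assumes cont: "continuous_on ({t0..t1} \<times> UNIV) (\<lambda>(t, x). F t x)"
    and bound: "\<And>t x. t \<in> {t0..t1} \<Longrightarrow> norm (F t x) \<le> M" and "t0 \<le> t1" and "d > 0"
  obtains y where "M-lipschitz_on {t0..t1} y"
    "\<And>t. t \<in> {t0..t1} \<Longrightarrow> y t = x0 + integral {t0..t} (\<lambda>s. F s (y (max t0 (s - d))))"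
proof -
  have "M \<ge> 0" using bound[of t0 x0] \<open>t0 \<le> t1\<close> norm_ge_zero[of "F t0 x0"] by (meson atLeastAtMost_iff order_refl order_trans)
  define P where "P y t = x0 + integral {t0..t} (\<lambda>s. F s (y (max t0 (s - d))))" for y t
  have cont_rhs: "continuous_on {t0..t1} (\<lambda>s. F s (y (max t0 (s - d))))" if "continuous_on {t0..t1} y" for y
  proof -
    have "continuous_on {t0..t1} (\<lambda>s. y (max t0 (s - d)))"
      by (rule continuous_on_compose2[OF that]) (use \<open>d > 0\<close> in \<open>auto intro!: continuous_intros\<close>)
    then have "continuous_on {t0..t1} (\<lambda>s. case (s, y (max t0 (s - d))) of (t, x) \<Rightarrow> F t x)"
      by (intro continuous_on_compose2[OF cont]) (auto intro!: continuous_intros)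
    then show ?thesis by simp
  qed
  have P_lip: "M-lipschitz_on {t0..t1} (P y)" if "continuous_on {t0..t1} y" for y
  proof (rule lipschitz_onI[OF _ \<open>M \<ge> 0\<close>])
    have *: "norm (P y t - P y s) \<le> M * (t - s)" if st: "s \<in> {t0..t1}" "t \<in> {t0..t1}" "s \<le> t" for s t
    proof -
      let ?G = "\<lambda>r. F r (y (max t0 (r - d)))"
      have int: "?G integrable_on {t0..t}"
        by (rule integrable_continuous_real, rule continuous_on_subset[OF cont_rhs[OF \<open>continuous_on {t0..t1} y\<close>]])
          (use st in auto)
      have "P y t - P y s = integral {s..t} ?G"
        using Henstock_Kurzweil_Integration.integral_combine[of t0 s t ?G] int st by (auto simp: P_def algebra_simps)
      also have "norm \<dots> \<le> M * (t - s)"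
        by (rule integral_bound) (use st in \<open>auto intro!: bound continuous_on_subset[OF cont_rhs[OF \<open>continuous_on {t0..t1} y\<close>]]\<close>)
      finally show ?thesis .
    qed
    fix s t assume "s \<in> {t0..t1}" "t \<in> {t0..t1}"
    then show "dist (P y s) (P y t) \<le> M * dist s t"
      using *[of s t] *[of t s] by (cases "s \<le> t") (auto simp: dist_norm norm_minus_commute)
  qed
  define Y where "Y m = (P ^^ m) (\<lambda>_. x0)" for m
  have Y_lip: "M-lipschitz_on {t0..t1} (Y m)" for m
  proof (induction m)
    case 0 then show ?case using \<open>M \<ge> 0\<close> by (simp add: Y_def lipschitz_on_def)
  next
    case (Suc m) then show ?case using P_lip[OF lipschitz_on_continuous_on] by (simp add: Y_def)
  qed
  have stable: "Y (Suc m) t = Y m t" if "t \<in> {t0..t1}" "t \<le> t0 + real m * d" for m t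
    using that
  proof (induction m arbitrary: t)
    case 0 then show ?case by (simp add: Y_def P_def)
  next
    case (Suc m)
    have "Y (Suc m) (max t0 (s - d)) = Y m (max t0 (s - d))" if "s \<in> {t0..t}" for s
      using that Suc.prems \<open>d > 0\<close> by (intro Suc.IH) (auto simp: algebra_simps)
    then have "P (Y (Suc m)) t = P (Y m) t" unfolding P_def by (intro arg_cong2[of _ _ _ _ "(+)"] integral_cong) auto
    then show ?case by (simp add: Y_def)
  qed
  obtain m where "t1 - t0 < real m * d" using reals_Archimedean3[OF \<open>d > 0\<close>] by blast
  then have "Y m t = P (Y m) t" if "t \<in> {t0..t1}" for t
    using stable[of t m] that by (simp add: Y_def)
  then show ?thesis using that[OF Y_lip[of m]] by (simp add: P_def)
qed

text \<open>The delayed solutions are uniformly Lipschitz and bounded, so by Arzela-Ascoli a subsequence with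
  delays tending to \<open>0\<close> converges; dominated convergence passes to the limit in the integral equation.\<close>
theorem peano_bounded:
  fixes F :: "real \<Rightarrow> 'a::euclidean_space \<Rightarrow> 'a"
  assumes cont: "continuous_on ({t0..t1} \<times> UNIV) (\<lambda>(t, x). F t x)"
    and bound: "\<And>t x. t \<in> {t0..t1} \<Longrightarrow> norm (F t x) \<le> M" and "t0 \<le> t1"
  obtains g where "g t0 = x0"
    "\<And>t. t \<in> {t0..t1} \<Longrightarrow> (g has_vector_derivative F t (g t)) (at t within {t0..t1})"
proof -
  define d where "d n = 1 / (real n + 1)" for n
  have d: "d n > 0" for n by (simp add: d_def)
  have "\<forall>n. \<exists>y. M-lipschitz_on {t0..t1} y \<and>
      (\<forall>t\<in>{t0..t1}. y t = x0 + integral {t0..t} (\<lambda>s. F s (y (max t0 (s - d n)))))"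
    using delayed_solution[OF cont bound \<open>t0 \<le> t1\<close> d] by metis
  then obtain y where lip: "\<And>n. M-lipschitz_on {t0..t1} (y n)"
    and y: "\<And>n t. t \<in> {t0..t1} \<Longrightarrow> y n t = x0 + integral {t0..t} (\<lambda>s. F s (y n (max t0 (s - d n))))"
    by metis
  have lip': "norm (y n s - y n t) \<le> M * \<bar>s - t\<bar>" if "s \<in> {t0..t1}" "t \<in> {t0..t1}" for n s t
    using lipschitz_onD[OF lip that] by (simp add: dist_norm dist_real_def)
  have "M \<ge> 0" using lip lipschitz_on_nonneg by blast
  have y_t0: "y n t0 = x0" for n using y[of t0 n] \<open>t0 \<le> t1\<close> by simp
  obtain g r where "continuous_on {t0..t1} g" and r: "strict_mono (r :: nat \<Rightarrow> nat)"
    and unif: "\<And>e. 0 < e \<Longrightarrow> \<exists>N. \<forall>n x. n \<ge> N \<and> x \<in> {t0..t1} \<longrightarrow> norm (y (r n) x - g x) < e"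
  proof (rule Arzela_Ascoli[of "{t0..t1}" y "norm x0 + M * (t1 - t0)"])
    show "norm (y n t) \<le> norm x0 + M * (t1 - t0)" if "t \<in> {t0..t1}" for n t
    proof -
      have "norm (y n t - y n t0) \<le> M * (t - t0)" using lip'[of t t0 n] that by simp
      also have "\<dots> \<le> M * (t1 - t0)" using that \<open>M \<ge> 0\<close> by (intro mult_left_mono) auto
      finally show ?thesis using norm_triangle_sub[of "y n t" x0] by (simp add: y_t0)
    qed
    show "\<exists>d>0. \<forall>n s. s \<in> {t0..t1} \<and> norm (t - s) < d \<longrightarrow> norm (y n t - y n s) < e"
      if "t \<in> {t0..t1}" "0 < e" for t e
    proof (intro exI[of _ "e / (M + 1)"] conjI allI impI)
      show "e / (M + 1) > 0" using that \<open>M \<ge> 0\<close> by simp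
      fix n s assume s: "s \<in> {t0..t1} \<and> norm (t - s) < e / (M + 1)"
      then have "norm (y n t - y n s) \<le> M * \<bar>t - s\<bar>" using lip' that by blast
      also have "\<dots> \<le> (M + 1) * \<bar>t - s\<bar>" by (intro mult_right_mono) auto
      also have "\<dots> < e" using s \<open>M \<ge> 0\<close> by (simp add: field_simps)
      finally show "norm (y n t - y n s) < e" .
    qed
  qed auto
  have lim: "(\<lambda>n. y (r n) t) \<longlonglongrightarrow> g t" if "t \<in> {t0..t1}" for t
    unfolding LIMSEQ_iff using unif that by meson
  have lim_delay: "(\<lambda>n. y (r n) (max t0 (s - d (r n)))) \<longlonglongrightarrow> g s" if "s \<in> {t0..t1}" for s
  proof -
    have "d \<longlonglongrightarrow> 0" unfolding d_def using LIMSEQ_inverse_real_of_nat by (simp add: inverse_eq_divide add.commute)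
    from LIMSEQ_subseq_LIMSEQ[OF this r] have "(\<lambda>n. M * d (r n)) \<longlonglongrightarrow> 0"
      by (auto simp: o_def intro: tendsto_eq_intros)
    then have "(\<lambda>n. y (r n) (max t0 (s - d (r n))) - y (r n) s) \<longlonglongrightarrow> 0"
    proof (rule Lim_null_comparison[rotated], intro always_eventually allI)
      fix n
      have "norm (y (r n) (max t0 (s - d (r n))) - y (r n) s) \<le> M * \<bar>max t0 (s - d (r n)) - s\<bar>"
        using that d[of "r n"] by (intro lip') auto
      also have "\<dots> \<le> M * d (r n)" using that d[of "r n"] \<open>M \<ge> 0\<close> by (intro mult_left_mono) auto
      finally show "norm (y (r n) (max t0 (s - d (r n))) - y (r n) s) \<le> M * d (r n)" .
    qed
    from tendsto_add[OF this lim[OF that]] show ?thesis by simp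
  qed
  have cont_slice: "continuous_on UNIV (F s)" if "s \<in> {t0..t1}" for s
  proof -
    have "continuous_on UNIV (\<lambda>x. case (s, x) of (t, x) \<Rightarrow> F t x)"
      by (rule continuous_on_compose2[OF cont]) (use that in \<open>auto intro!: continuous_intros\<close>)
    then show ?thesis by simp
  qed
  have cont_along: "continuous_on {t0..t1} (\<lambda>s. F s (h s))" if "continuous_on {t0..t1} h" for h
  proof -
    have "continuous_on {t0..t1} (\<lambda>s. case (s, h s) of (t, x) \<Rightarrow> F t x)"
      by (rule continuous_on_compose2[OF cont]) (use that in \<open>auto intro!: continuous_intros\<close>)
    then show ?thesis by simp
  qed
  have g: "g t = x0 + integral {t0..t} (\<lambda>s. F s (g s))" if t: "t \<in> {t0..t1}" for t
  proof -
    have "(\<lambda>n. integral {t0..t} (\<lambda>s. F s (y (r n) (max t0 (s - d (r n)))))) \<longlonglongrightarrow> integral {t0..t} (\<lambda>s. F s (g s))"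
    proof (rule dominated_convergence(2)[where h = "\<lambda>_. M"])
      fix n
      have "continuous_on {t0..t1} (\<lambda>s. y (r n) (max t0 (s - d (r n))))"
        by (rule continuous_on_compose2[OF lipschitz_on_continuous_on[OF lip]])
          (use d[of "r n"] in \<open>auto intro!: continuous_intros\<close>)
      from cont_along[OF this] have "continuous_on {t0..t} (\<lambda>s. F s (y (r n) (max t0 (s - d (r n)))))"
        by (rule continuous_on_subset) (use t in auto)
      then show "(\<lambda>s. F s (y (r n) (max t0 (s - d (r n))))) integrable_on {t0..t}"
        by (rule integrable_continuous_real)
    next
      fix s assume "s \<in> {t0..t}"
      then have s: "s \<in> {t0..t1}" using t by auto
      show "(\<lambda>n. F s (y (r n) (max t0 (s - d (r n))))) \<longlonglongrightarrow> F s (g s)"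
        using continuous_on_tendsto_compose[OF cont_slice[OF s] lim_delay[OF s]] by simp
    qed (use t bound in auto)
    then have "(\<lambda>n. y (r n) t) \<longlonglongrightarrow> x0 + integral {t0..t} (\<lambda>s. F s (g s))"
      unfolding y[OF t] by (intro tendsto_intros)
    with lim[OF t] show ?thesis using LIMSEQ_unique by blast
  qed
  show ?thesis
  proof
    show "g t0 = x0" using g[of t0] \<open>t0 \<le> t1\<close> by simp
    fix t assume t: "t \<in> {t0..t1}"
    have "((\<lambda>u. x0 + integral {t0..u} (\<lambda>s. F s (g s))) has_vector_derivative F t (g t)) (at t within {t0..t1})"
      using integral_has_vector_derivative[OF cont_along[OF \<open>continuous_on {t0..t1} g\<close>] t]
      by (auto intro!: derivative_eq_intros)
    then show "(g has_vector_derivative F t (g t)) (at t within {t0..t1})"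
      by (rule has_vector_derivative_transform[OF t g, rotated])
  qed
qed

section \<open>Solutions of the differential equation\<close>

lemma ode_solution_right_derivative:
  assumes "ode_solution f t0 x0 T \<phi>" "t0 \<le> t" "ereal t < T"
  shows "(\<phi> has_vector_derivative f t (\<phi> t)) (at_right t)"
proof -
  obtain z where z: "t < z" "ereal z < T"
    using ereal_dense2[OF assms(3)] by auto
  have "{t..z} \<subseteq> time_interval t0 T"
    using assms(2) z(2) by (auto intro: le_less_trans[rotated])
  then have "(\<phi> has_vector_derivative f t (\<phi> t)) (at t within {t..z})"
    using assms unfolding ode_solution_def
    by (auto intro: has_vector_derivative_within_subset)
  then show ?thesis using z(1) by (simp add: at_within_Icc_at_right)
qed

lemma ode_solution_continuous_on:
  assumes "ode_solution f t0 x0 T \<phi>" "t0 \<le> a" "ereal c < T"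
  shows "continuous_on {a..c} \<phi>"
proof -
  have "continuous_on (time_interval t0 T) \<phi>"
    using assms(1) unfolding ode_solution_def
    by (intro continuous_on_vector_derivative[where f' = "\<lambda>t. f t (\<phi> t)"]) auto
  then show ?thesis
    by (rule continuous_on_subset) (use assms(2,3) in \<open>auto intro: le_less_trans[rotated]\<close>)
qed

lemma ode_solutionI_Icc:
  assumes "t0 < t1" "\<phi> t0 = x0"
    and "\<And>t. t \<in> {t0..<t1} \<Longrightarrow> (\<phi> has_vector_derivative f t (\<phi> t)) (at t within {t0..t1})"
  shows "ode_solution f t0 x0 (ereal t1) \<phi>"
  unfolding ode_solution_def
  using assms by (auto intro!: has_vector_derivative_within_subset[OF assms(3)])

text \<open>The field \<open>f\<close> is made bounded by projecting the state onto a closed ball around the initial value;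
  the solution of the modified equation solves the original one as long as it stays in the ball.\<close>
lemma solution_while_near_start:
  fixes f :: "real \<Rightarrow> 'a::euclidean_space \<Rightarrow> 'a"
  assumes cont: "continuous_on ({0..} \<times> UNIV) (\<lambda>(t, x). f t x)"
    and t0: "0 \<le> t0" and "t0 < t1" and r: "0 \<le> r"
  obtains g where "g t0 = x0" "continuous_on {t0..t1} g"
    "\<And>\<tau>. \<lbrakk>t0 < \<tau>; \<tau> \<le> t1; \<And>t. t \<in> {t0..<\<tau>} \<Longrightarrow> dist x0 (g t) \<le> r\<rbrakk>
      \<Longrightarrow> ode_solution f t0 x0 (ereal \<tau>) g"
proof -
  define p where "p = closest_point (cball x0 r)"
  have p_in: "p x \<in> cball x0 r" for x
    unfolding p_def by (rule closest_point_in_set) (use r in auto)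
  have p_id: "p x = x" if "dist x0 x \<le> r" for x
    unfolding p_def by (rule closest_point_self) (use that in auto)
  have cont_p: "continuous_on S p" for S
    unfolding p_def by (rule continuous_on_closest_point) (use r in auto)
  let ?K = "{t0..t1} \<times> cball x0 r"
  have "compact ((\<lambda>(t, x). f t x) ` ?K)"
    by (intro compact_continuous_image compact_Times continuous_on_subset[OF cont]) (use t0 in auto)
  then obtain M where M: "\<And>t x. t \<in> {t0..t1} \<Longrightarrow> x \<in> cball x0 r \<Longrightarrow> norm (f t x) \<le> M"
    by (fastforce dest!: compact_imp_bounded simp: bounded_iff)
  have "continuous_on ({t0..t1} \<times> UNIV) (\<lambda>z. case (fst z, p (snd z)) of (t, x) \<Rightarrow> f t x)"
    by (rule continuous_on_compose2[OF cont])
      (use t0 in \<open>auto intro!: continuous_intros continuous_on_compose2[OF cont_p]\<close>)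
  then have cont': "continuous_on ({t0..t1} \<times> UNIV) (\<lambda>(t, x). f t (p x))"
    by (simp add: case_prod_unfold)
  obtain g where g: "g t0 = x0"
    "\<And>t. t \<in> {t0..t1} \<Longrightarrow> (g has_vector_derivative f t (p (g t))) (at t within {t0..t1})"
    using peano_bounded[OF cont', of M x0] M p_in \<open>t0 < t1\<close> by auto
  show ?thesis
  proof
    show "g t0 = x0" by fact
    show "continuous_on {t0..t1} g"
      using g(2) by (rule continuous_on_vector_derivative)
    fix \<tau> assume \<tau>: "t0 < \<tau>" "\<tau> \<le> t1" "\<And>t. t \<in> {t0..<\<tau>} \<Longrightarrow> dist x0 (g t) \<le> r"
    show "ode_solution f t0 x0 (ereal \<tau>) g"
    proof (rule ode_solutionI_Icc[where \<phi> = g, OF \<open>t0 < \<tau>\<close> g(1)])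
      fix t assume t: "t \<in> {t0..<\<tau>}"
      then have "(g has_vector_derivative f t (p (g t))) (at t within {t0..\<tau>})"
        using has_vector_derivative_within_subset[OF g(2), of t "{t0..\<tau>}"] \<tau>(2) by auto
      then show "(g has_vector_derivative f t (g t)) (at t within {t0..\<tau>})"
        using p_id[OF \<tau>(3)[OF t]] by simp
    qed
  qed
qed

theorem peano_local:
  fixes f :: "real \<Rightarrow> 'a::euclidean_space \<Rightarrow> 'a"
  assumes "continuous_on ({0..} \<times> UNIV) (\<lambda>(t, x). f t x)" and "0 \<le> t0"
  obtains T \<phi> where "ode_solution f t0 x0 T \<phi>"
proof -
  obtain g where g: "g t0 = x0" "continuous_on {t0..t0 + 1} g"
    "\<And>\<tau>. \<lbrakk>t0 < \<tau>; \<tau> \<le> t0 + 1; \<And>t. t \<in> {t0..<\<tau>} \<Longrightarrow> dist x0 (g t) \<le> 1\<rbrakk>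
      \<Longrightarrow> ode_solution f t0 x0 (ereal \<tau>) g"
    using solution_while_near_start[OF assms, of "t0 + 1" 1 x0] by (auto simp del: atLeastLessThan_iff)
  obtain d where "d > 0" and d: "\<And>t. t \<in> {t0..t0 + 1} \<Longrightarrow> dist t t0 < d \<Longrightarrow> dist (g t) (g t0) < 1"
    using g(2)[unfolded continuous_on_iff, rule_format, of t0 1] by auto
  show ?thesis
  proof (rule that, rule g(3)[of "t0 + min 1 d"])
    show "dist x0 (g t) \<le> 1" if "t \<in> {t0..<t0 + min 1 d}" for t
      using d[of t] that by (auto simp: g(1) dist_commute dist_real_def min_def split: if_splits)
  qed (use \<open>d > 0\<close> in auto)
qed

section \<open>Equivalence of the growth conditions\<close>

lemma dini_solution_difference:
  fixes f :: "real \<Rightarrow> 'a::euclidean_space \<Rightarrow> 'a"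
  assumes "is_norm N" "ode_solution f t0 x0 T1 \<phi>" "ode_solution f t0 y0 T2 \<psi>"
    "t0 \<le> t" "ereal t < T1" "ereal t < T2"
  shows "upper_right_dini (\<lambda>s. N (\<phi> s - \<psi> s)) t
    = ereal (dir_deriv N (\<phi> t - \<psi> t) (f t (\<phi> t) - f t (\<psi> t)))"
  using assms
  by (intro upper_right_dini_norm_curve(2)[where c = "\<lambda>s. \<phi> s - \<psi> s"] has_vector_derivative_diff)
    (auto intro: ode_solution_right_derivative)

text \<open>The Dini derivative of the distance of two solutions is the directional derivative at their current
  states. For one direction these states lie in \<open>C\<close> by forward invariance; for the other, Peano's theorem
  starts solutions at any prescribed time and pair of states, and the Dini inequality is read off at the
  initial time.\<close>
lemma growth_iff_dini:
  fixes f :: "real \<Rightarrow> 'a::euclidean_space \<Rightarrow> 'a"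
  assumes cont: "continuous_on ({0..} \<times> UNIV) (\<lambda>(t, x). f t x)"
    and inv: "forward_invariant f C" and N: "is_norm N"
  shows "growth_condition N f C b \<longleftrightarrow> dini_condition N f C b"
proof
  assume growth: "growth_condition N f C b"
  show "dini_condition N f C b"
    unfolding dini_condition_def
  proof (intro allI impI ballI, elim conjE)
    fix t0 x0 y0 T1 T2 \<phi> \<psi> t
    assume *: "0 \<le> t0" "x0 \<in> C" "y0 \<in> C" and sol: "ode_solution f t0 x0 T1 \<phi>" "ode_solution f t0 y0 T2 \<psi>"
      and t: "t0 \<le> t" "ereal t < T1" "ereal t < T2"
    have "\<phi> t \<in> C" "\<psi> t \<in> C"
      using inv * sol t unfolding forward_invariant_def by blast+
    then show "upper_right_dini (\<lambda>s. N (\<phi> s - \<psi> s)) t \<le> ereal (b * N (\<phi> t - \<psi> t))"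
      using growth *(1) t(1) by (simp add: growth_condition_def dini_solution_difference[OF N sol t])
  qed
next
  assume dini: "dini_condition N f C b"
  show "growth_condition N f C b"
    unfolding growth_condition_def
  proof (intro allI impI ballI)
    fix t :: real and x y assume *: "0 \<le> t" "x \<in> C" "y \<in> C"
    obtain T1 \<phi> where \<phi>: "ode_solution f t x T1 \<phi>" using peano_local[OF cont *(1)] .
    obtain T2 \<psi> where \<psi>: "ode_solution f t y T2 \<psi>" using peano_local[OF cont *(1)] .
    have start: "\<phi> t = x" "\<psi> t = y" "ereal t < T1" "ereal t < T2"
      using \<phi> \<psi> by (auto simp: ode_solution_def)
    have "upper_right_dini (\<lambda>s. N (\<phi> s - \<psi> s)) t \<le> ereal (b * N (\<phi> t - \<psi> t))"
      using dini * \<phi> \<psi> start(3,4) unfolding dini_condition_def by blast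
    then show "dir_deriv N (x - y) (f t x - f t y) \<le> b * N (x - y)"
      using dini_solution_difference[OF N \<phi> \<psi> order_refl start(3,4)] start(1,2) by simp
  qed
qed

lemma dini_iff_incremental:
  fixes f :: "real \<Rightarrow> 'a::euclidean_space \<Rightarrow> 'a"
  assumes N: "is_norm N"
  shows "dini_condition N f C b \<longleftrightarrow> incremental_condition N f C b"
proof
  assume dini: "dini_condition N f C b"
  show "incremental_condition N f C b"
    unfolding incremental_condition_def
  proof (intro allI impI ballI, elim conjE)
    fix t0 x0 y0 T1 T2 \<phi> \<psi> s t
    assume *: "0 \<le> t0" "x0 \<in> C" "y0 \<in> C"
      and sol: "ode_solution f t0 x0 T1 \<phi>" "ode_solution f t0 y0 T2 \<psi>"
      and t: "t0 \<le> s" "s \<le> t" "ereal t < T1" "ereal t < T2"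
    have "continuous_on {s..t} (\<lambda>r. N (\<phi> r - \<psi> r))"
      by (rule continuous_on_compose2[OF is_norm_continuous_on[OF N, of UNIV]])
        (use sol t in \<open>auto intro!: continuous_on_diff intro: ode_solution_continuous_on\<close>)
    moreover have "upper_right_dini (\<lambda>r. N (\<phi> r - \<psi> r)) r \<le> ereal (b * N (\<phi> r - \<psi> r))"
      if "r \<in> {s..<t}" for r
    proof -
      have "t0 \<le> r" "ereal r < T1" "ereal r < T2"
        using that t by (auto intro: less_trans[of "ereal r" "ereal t"])
      then show ?thesis using dini * sol unfolding dini_condition_def by blast
    qed
    ultimately show "N (\<phi> t - \<psi> t) \<le> exp (b * (t - s)) * N (\<phi> s - \<psi> s)"
      using dini_gronwall[OF t(2)] by blast
  qed
next
  assume incr: "incremental_condition N f C b"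
  show "dini_condition N f C b"
    unfolding dini_condition_def
  proof (intro allI impI ballI, elim conjE)
    fix t0 x0 y0 T1 T2 \<phi> \<psi> t
    assume *: "0 \<le> t0" "x0 \<in> C" "y0 \<in> C"
      and sol: "ode_solution f t0 x0 T1 \<phi>" "ode_solution f t0 y0 T2 \<psi>"
      and t: "t0 \<le> t" "ereal t < T1" "ereal t < T2"
    define u where "u s = N (\<phi> s - \<psi> s)" for s
    obtain z where z: "t < z" "ereal z < min T1 T2"
      using ereal_dense2[of "ereal t" "min T1 T2"] t by auto
    have "((\<lambda>h. exp (b * h)) has_real_derivative b) (at_right 0)"
      by (auto intro!: derivative_eq_intros)
    then have "((\<lambda>h. (exp (b * h) - 1) / h) \<longlongrightarrow> b) (at_right 0)"
      by (simp add: has_field_derivative_iff)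
    then have lim: "((\<lambda>h. ereal ((exp (b * h) - 1) / h * u t)) \<longlongrightarrow> ereal (b * u t)) (at_right 0)"
      by (intro tendsto_intros)
    have "upper_right_dini u t \<le> Limsup (at_right 0) (\<lambda>h. ereal ((exp (b * h) - 1) / h * u t))"
      unfolding upper_right_dini_def
    proof (rule Limsup_mono, unfold eventually_at_right_field, intro exI[of _ "z - t"] conjI allI impI)
      fix h assume h: "0 < h" "h < z - t"
      have "ereal (t + h) < min T1 T2" using h z(2) by (auto intro: less_trans[of "ereal (t + h)" "ereal z"])
      then have "u (t + h) \<le> exp (b * (t + h - t)) * u t"
        using incr * sol t(1) h(1) unfolding incremental_condition_def u_def
        by (meson less_add_same_cancel1 less_imp_le min_less_iff_conj)
      then have "(u (t + h) - u t) / h \<le> (exp (b * h) - 1) * u t / h"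
        using h by (intro divide_right_mono) (auto simp: algebra_simps)
      then show "ereal ((u (t + h) - u t) / h) \<le> ereal ((exp (b * h) - 1) / h * u t)" by simp
    qed (use z in simp)
    also have "\<dots> = ereal (b * u t)" by (rule lim_imp_Limsup[OF _ lim]) simp
    finally show "upper_right_dini (\<lambda>s. N (\<phi> s - \<psi> s)) t \<le> ereal (b * N (\<phi> t - \<psi> t))"
      by (simp add: u_def[abs_def])
  qed
qed

lemma incremental_imp_unique:
  assumes N: "is_norm N" and incr: "incremental_condition N f C b"
  shows "unique_solutions f C"
  unfolding unique_solutions_def
proof (intro allI impI ballI, elim conjE)
  fix t0 x0 T1 T2 \<phi> \<psi> t
  assume *: "0 \<le> t0" "x0 \<in> C" and sol: "ode_solution f t0 x0 T1 \<phi>" "ode_solution f t0 x0 T2 \<psi>"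
    and t: "t0 \<le> t" "ereal t < T1" "ereal t < T2"
  have "N (\<phi> t - \<psi> t) \<le> exp (b * (t - t0)) * N (\<phi> t0 - \<psi> t0)"
    using incr * sol t unfolding incremental_condition_def by blast
  also have "\<phi> t0 - \<psi> t0 = 0" using sol by (simp add: ode_solution_def)
  finally have "N (\<phi> t - \<psi> t) \<le> 0" by (simp add: is_norm_zero[OF N])
  then show "\<phi> t = \<psi> t"
    using is_norm_nonneg[OF N, of "\<phi> t - \<psi> t"] is_norm_eq_0[OF N, of "\<phi> t - \<psi> t"] by simp
qed

section \<open>Global existence\<close>

text \<open>The growth condition compares any two points, so the solution can be compared with the constant curve
  \<open>x0\<close> although this is no solution: the defect contributes at most \<open>N (f t x0)\<close> to the growth of the
  distance.\<close>
lemma a_priori_bound: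
  fixes f :: "real \<Rightarrow> 'a::euclidean_space \<Rightarrow> 'a"
  assumes inv: "forward_invariant f C" and N: "is_norm N"
    and growth: "growth_condition N f C b" and "b \<le> 0"
    and "0 \<le> t0" "x0 \<in> C" and sol: "ode_solution f t0 x0 (ereal T) \<phi>"
    and M: "\<And>t. t \<in> {t0..T} \<Longrightarrow> N (f t x0) \<le> M" and t: "t \<in> {t0..<T}"
  shows "N (\<phi> t - x0) \<le> M * (t - t0)"
proof -
  let ?u = "\<lambda>s. N (\<phi> s - x0)"
  have cont: "continuous_on {t0..t} ?u"
    by (rule continuous_on_compose2[OF is_norm_continuous_on[OF N, of UNIV]])
      (use sol t in \<open>auto intro!: continuous_on_diff intro: ode_solution_continuous_on\<close>)
  have dini: "upper_right_dini ?u s \<le> ereal M" if s: "s \<in> {t0..<t}" for s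
  proof -
    have in_C: "\<phi> s \<in> C"
      using inv \<open>0 \<le> t0\<close> \<open>x0 \<in> C\<close> sol s t unfolding forward_invariant_def by fastforce
    have "((\<lambda>s. \<phi> s - x0) has_vector_derivative f s (\<phi> s)) (at_right s)"
      using ode_solution_right_derivative[OF sol, of s] s t by (auto intro!: derivative_eq_intros)
    from upper_right_dini_norm_curve(2)[OF N this]
    have "upper_right_dini ?u s = ereal (dir_deriv N (\<phi> s - x0) (f s (\<phi> s)))" .
    moreover have "dir_deriv N (\<phi> s - x0) (f s (\<phi> s))
        \<le> dir_deriv N (\<phi> s - x0) (f s (\<phi> s) - f s x0) + N (f s x0)"
      using dir_deriv_add_le[OF N, of "\<phi> s - x0" "f s (\<phi> s) - f s x0" "f s x0"] by simp
    moreover have "dir_deriv N (\<phi> s - x0) (f s (\<phi> s) - f s x0) \<le> b * N (\<phi> s - x0)"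
      using growth in_C \<open>x0 \<in> C\<close> \<open>0 \<le> t0\<close> s by (simp add: growth_condition_def)
    moreover have "b * N (\<phi> s - x0) \<le> 0"
      using \<open>b \<le> 0\<close> is_norm_nonneg[OF N] by (simp add: mult_nonpos_nonneg)
    moreover have "N (f s x0) \<le> M" using M s t by simp
    ultimately show ?thesis by simp
  qed
  have "?u t \<le> M * (t - t0) + e" if "e > 0" for e
  proof -
    define e' where "e' = e / (t - t0 + 1)"
    have "e' > 0" using that t by (simp add: e'_def)
    have "?u t \<le> ?u t0 + (M + e') * (t - t0)"
    proof (rule right_growth_comparison[OF _ cont])
      fix s assume "s \<in> {t0..<t}"
      then have "upper_right_dini ?u s < ereal (M + e')"
        using dini \<open>e' > 0\<close> by (fastforce intro: le_less_trans)
      from upper_right_dini_less_imp[OF this]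
      show "\<forall>\<^sub>F h in at_right 0. ?u (s + h) \<le> ?u s + (M + e') * h"
        by eventually_elim simp
    qed (use t in simp)
    also have "?u t0 = 0" using sol by (simp add: ode_solution_def is_norm_zero[OF N])
    also have "e' * (t - t0) \<le> e" using that t by (simp add: e'_def field_simps)
    then have "0 + (M + e') * (t - t0) \<le> M * (t - t0) + e" by (simp add: distrib_right)
    finally show ?thesis .
  qed
  then show ?thesis by (rule field_le_epsilon)
qed

text \<open>A solution of the projected equation on the whole interval never leaves the ball: up to a
  first exit it would solve the original equation, and the a priori bound \<open>R\<close> would keep it strictly inside.\<close>
lemma solution_on_bounded_interval:
  fixes f :: "real \<Rightarrow> 'a::euclidean_space \<Rightarrow> 'a"
  assumes cont: "continuous_on ({0..} \<times> UNIV) (\<lambda>(t, x). f t x)"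
    and inv: "forward_invariant f C" and N: "is_norm N"
    and growth: "growth_condition N f C b" and "b \<le> 0"
    and t0: "0 \<le> t0" and x0: "x0 \<in> C" and "t0 < t1"
  obtains \<phi> where "ode_solution f t0 x0 (ereal t1) \<phi>"
proof -
  obtain k where "k > 0" and k: "\<And>x. k * norm x \<le> N x" using is_norm_lower_bound[OF N] by blast
  have "continuous_on {t0..t1} (\<lambda>t. case (t, x0) of (t, x) \<Rightarrow> f t x)"
    by (rule continuous_on_compose2[OF cont]) (use t0 in \<open>auto intro!: continuous_intros\<close>)
  then have "continuous_on {t0..t1} (\<lambda>t. N (f t x0))"
    using continuous_on_compose2[OF is_norm_continuous_on[OF N, of UNIV]] by fastforce
  then obtain M where M: "\<And>t. t \<in> {t0..t1} \<Longrightarrow> N (f t x0) \<le> M"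
    using continuous_attains_sup[of "{t0..t1}"] \<open>t0 < t1\<close> by fastforce
  have "M \<ge> 0" using M[of t0] \<open>t0 < t1\<close> is_norm_nonneg[OF N, of "f t0 x0"] by simp
  \<comment> \<open>\<open>R\<close> is the a priori bound in the Euclidean norm; the ball gets radius \<open>R + 1\<close> so that an exit contradicts it.\<close>
  define R where "R = M * (t1 - t0) / k"
  have "R \<ge> 0" using \<open>M \<ge> 0\<close> \<open>k > 0\<close> \<open>t0 < t1\<close> by (simp add: R_def)
  obtain g where g0: "g t0 = x0" and cont_g: "continuous_on {t0..t1} g"
    and g: "\<And>\<tau>. \<lbrakk>t0 < \<tau>; \<tau> \<le> t1; \<And>t. t \<in> {t0..<\<tau>} \<Longrightarrow> dist x0 (g t) \<le> R + 1\<rbrakk>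
      \<Longrightarrow> ode_solution f t0 x0 (ereal \<tau>) g"
    using solution_while_near_start[OF cont t0 \<open>t0 < t1\<close>, of "R + 1" x0] \<open>R \<ge> 0\<close> by (metis add_nonneg_nonneg zero_le_one)
  define \<rho> where "\<rho> t = dist x0 (g t)" for t
  have cont_\<rho>: "continuous_on {t0..t1} \<rho>" unfolding \<rho>_def by (intro continuous_intros cont_g)
  have bound: "\<rho> t \<le> R" if \<tau>: "t0 < \<tau>" "\<tau> \<le> t1" "\<And>t. t \<in> {t0..<\<tau>} \<Longrightarrow> \<rho> t \<le> R + 1" and t: "t \<in> {t0..<\<tau>}" for \<tau> t
  proof -
    have sol: "ode_solution f t0 x0 (ereal \<tau>) g" using g \<tau> by (simp add: \<rho>_def)
    have "k * norm (g t - x0) \<le> N (g t - x0)" by (rule k)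
    also have "\<dots> \<le> M * (t - t0)"
      using a_priori_bound[OF inv N growth \<open>b \<le> 0\<close> t0 x0 sol, of M t] M \<tau>(2) t by auto
    also have "\<dots> \<le> M * (t1 - t0)" using \<open>M \<ge> 0\<close> t \<tau>(2) by (intro mult_left_mono) auto
    finally show ?thesis using \<open>k > 0\<close>
      by (simp add: \<rho>_def R_def dist_norm norm_minus_commute field_simps)
  qed
  have "\<rho> t \<le> R + 1" if t: "t \<in> {t0..t1}" for t
  proof (rule ccontr)
    define S where "S = {t0..t1} \<inter> \<rho> -` {R + 1}"
    assume "\<not> \<rho> t \<le> R + 1"
    moreover have "\<rho> t0 = 0" by (simp add: \<rho>_def g0)
    ultimately obtain s where "t0 \<le> s" "s \<le> t" "\<rho> s = R + 1"
      using IVT'[of \<rho> t0 "R + 1" t] continuous_on_subset[OF cont_\<rho>, of "{t0..t}"] \<open>R \<ge> 0\<close> t by auto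
    then have "s \<in> S" using t by (simp add: S_def)
    then have "S \<noteq> {}" by blast
    moreover have "compact S"
      using continuous_closed_preimage[OF cont_\<rho>, of "{R + 1}"]
      by (simp add: compact_eq_bounded_closed S_def bounded_Int)
    ultimately obtain \<tau> where \<tau>: "\<tau> \<in> S" "\<And>s. s \<in> S \<Longrightarrow> \<tau> \<le> s"
      using compact_attains_inf[of S] by blast
    have "t0 < \<tau>" "\<tau> \<le> t1" "\<rho> \<tau> = R + 1"
      using \<tau>(1) \<open>\<rho> t0 = 0\<close> \<open>R \<ge> 0\<close> by (auto simp: S_def less_le)
    have before: "\<rho> s \<le> R + 1" if "s \<in> {t0..<\<tau>}" for s
    proof (rule ccontr)
      assume "\<not> \<rho> s \<le> R + 1"
      then have "\<exists>r\<ge>t0. r \<le> s \<and> \<rho> r = R + 1"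
        using \<open>R \<ge> 0\<close> \<open>\<rho> t0 = 0\<close> that \<open>\<tau> \<le> t1\<close>
        by (intro IVT' continuous_on_subset[OF cont_\<rho>]) auto
      then show False using \<tau>(2) that \<open>\<tau> \<le> t1\<close> by (force simp: S_def)
    qed
    have "\<rho> s \<le> R" if "s \<in> {t0..<\<tau>}" for s
      by (rule bound[OF \<open>t0 < \<tau>\<close> \<open>\<tau> \<le> t1\<close> before that])
    then have "\<rho> \<tau> \<le> R"
      using continuous_le_on_closure[of "{t0..<\<tau>}" \<rho> \<tau> R] \<open>t0 < \<tau>\<close> \<open>\<tau> \<le> t1\<close>
        continuous_on_subset[OF cont_\<rho>, of "{t0..\<tau>}"] by simp
    then show False using \<open>\<rho> \<tau> = R + 1\<close> by simp
  qed
  then have "ode_solution f t0 x0 (ereal t1) g"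
    using g[OF \<open>t0 < t1\<close>] by (simp add: \<rho>_def)
  then show ?thesis by (rule that)
qed

text \<open>By uniqueness, solutions on different intervals agree where both exist. The value at \<open>t\<close> is taken from
  the solution up to \<open>t + 1\<close>, so that it agrees with one fixed solution in a neighbourhood of \<open>t\<close>.\<close>
lemma glue_unique_solutions:
  fixes f :: "real \<Rightarrow> 'a::euclidean_space \<Rightarrow> 'a"
  assumes uniq: "unique_solutions f C" and t0: "0 \<le> t0" and x0: "x0 \<in> C"
    and ex: "\<And>t1. t0 < t1 \<Longrightarrow> \<exists>\<phi>. ode_solution f t0 x0 (ereal t1) \<phi>"
  obtains \<phi> where "ode_solution f t0 x0 \<infinity> \<phi>"
proof -
  obtain \<Phi> where \<Phi>: "\<And>t1. t0 < t1 \<Longrightarrow> ode_solution f t0 x0 (ereal t1) (\<Phi> t1)"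
    using ex by metis
  define \<phi> where "\<phi> t = \<Phi> (t + 1) t" for t
  have eq: "\<phi> t = \<Phi> t1 t" if "t0 \<le> t" "t < t1" for t t1
  proof -
    have "ode_solution f t0 x0 (ereal (t + 1)) (\<Phi> (t + 1))" "ode_solution f t0 x0 (ereal t1) (\<Phi> t1)"
      using \<Phi> that by auto
    then show ?thesis
      using uniq t0 x0 that unfolding unique_solutions_def \<phi>_def
      by (metis ereal_less(2) less_add_one less_ereal.simps(1))
  qed
  have "(\<phi> has_vector_derivative f t (\<phi> t)) (at t within {t0..})" if "t0 \<le> t" for t
  proof -
    let ?T = "t + 1"
    have "(\<Phi> ?T has_vector_derivative f t (\<Phi> ?T t)) (at t within time_interval t0 (ereal ?T))"
      using \<Phi>[of ?T] that unfolding ode_solution_def by auto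
    moreover have "time_interval t0 (ereal ?T) = {t0..} \<inter> {..<?T}" by auto
    ultimately have "(\<Phi> ?T has_vector_derivative f t (\<phi> t)) (at t within {t0..} \<inter> {..<?T})"
      by (simp add: \<phi>_def)
    then have "(\<phi> has_vector_derivative f t (\<phi> t)) (at t within {t0..} \<inter> {..<?T})"
      by (rule has_vector_derivative_transform[rotated 2]) (use that eq in auto)
    moreover have "at t within {t0..} \<inter> {..<?T} = at t within {t0..}"
      by (rule at_within_nhd[of _ "{..<?T}"]) auto
    ultimately show ?thesis by simp
  qed
  moreover have "\<phi> t0 = x0" using \<Phi>[of "t0 + 1"] by (simp add: \<phi>_def ode_solution_def)
  moreover have "time_interval t0 \<infinity> = {t0..}" by auto
  ultimately have "ode_solution f t0 x0 \<infinity> \<phi>" by (simp add: ode_solution_def)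
  then show ?thesis by (rule that)
qed

section \<open>Equivalence, uniqueness and global existence\<close>

theorem theorem31:
  fixes f :: "real \<Rightarrow> real ^ 'n \<Rightarrow> real ^ 'n"
    and C :: "(real ^ 'n) set"
    and N :: "real ^ 'n \<Rightarrow> real"
    and W :: "real ^ 'n \<Rightarrow> real ^ 'n \<Rightarrow> real"
    and b :: real
  assumes "continuous_on ({0..} \<times> UNIV) (\<lambda>(t, x). f t x)"
    and "open C" and "connected C" and "forward_invariant f C"
    and "is_norm N" and "weak_pairing W" and "compatible_pairing N W"
    and "deimling N W" and "curve_norm_derivative_formula N W"
  shows "(osL_condition N W f C b \<longleftrightarrow> dini_condition N f C b)
       \<and> (dini_condition N f C b \<longleftrightarrow> incremental_condition N f C b)
       \<and> (osL_condition N W f C b \<and> dini_condition N f C b \<and> incremental_condition N f C b \<longrightarrow>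
            unique_solutions f C)
       \<and> (osL_condition N W f C b \<and> dini_condition N f C b \<and> incremental_condition N f C b \<and>
          b < 0 \<and> (\<exists>xstar. \<forall>t\<ge>0. f t xstar = 0) \<longrightarrow>
            unique_solutions f C \<and>
            (\<forall>t0\<ge>0. \<forall>x0\<in>C. \<exists>\<phi>. ode_solution f t0 x0 \<infinity> \<phi>))"
proof -
  have cont_slice: "continuous_on UNIV (f t)" if "t \<ge> 0" for t
  proof -
    have "continuous_on UNIV (\<lambda>x. case (t, x) of (t, x) \<Rightarrow> f t x)"
      by (rule continuous_on_compose2[OF assms(1)]) (use that in \<open>auto intro!: continuous_intros\<close>)
    then show ?thesis by simp
  qed
  have osL: "osL_condition N W f C b \<longleftrightarrow> growth_condition N f C b"
    by (rule osL_condition_iff_growth) (use assms cont_slice in auto)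
  have dini: "growth_condition N f C b \<longleftrightarrow> dini_condition N f C b"
    by (rule growth_iff_dini) (use assms in auto)
  have incr: "dini_condition N f C b \<longleftrightarrow> incremental_condition N f C b"
    by (rule dini_iff_incremental) (use assms in auto)
  have uniq: "unique_solutions f C" if "incremental_condition N f C b"
    using incremental_imp_unique[OF \<open>is_norm N\<close> that] .
  have glob: "\<exists>\<phi>. ode_solution f t0 x0 \<infinity> \<phi>"
    if "incremental_condition N f C b" "b < 0" "t0 \<ge> 0" "x0 \<in> C" for t0 x0
  proof -
    have "\<exists>\<phi>. ode_solution f t0 x0 (ereal t1) \<phi>" if "t0 < t1" for t1
      using solution_on_bounded_interval[OF assms(1,4,5) _ _ \<open>t0 \<ge> 0\<close> \<open>x0 \<in> C\<close> that]
        \<open>incremental_condition N f C b\<close> \<open>b < 0\<close> dini incr by (metis less_imp_le)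
    then show ?thesis
      using glue_unique_solutions[OF uniq[OF that(1)] that(3,4)] by metis
  qed
  show ?thesis using osL dini incr uniq glob by blast
qed

end
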